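(* Let $K$ be a unitgenerated idempotent semiring. Let $v:K\rightarrow E$ be a surjective homomorphism onto some totally ordered idempotent semifield $E$. Let $L$ be an idempotent semifield containing $K$ as a subsemiring, and let $i:K\rightarrow L$ be the inclusion. Then there is a totally ordered idempotent semifield $F$, an injective homomorphism $j:E\rightarrow F$, and a homomorphism $w:L\rightarrow F$ such that $w\circ i=j\circ v$.
   Context: Semirings are commutative with $0$ and $1$; homomorphisms preserve $+,\cdot,0,1$. A semiring is idempotent if $x+x=x$ for all $x$; it then carries the canonical partial order $x\leq y\iff x+y=y$. An idempotent semifield is an idempotent semiring with $0\neq 1$ in which every nonzero element is a unit; it is totally ordered if its canonical order is total. An idempotent semiring is unitgenerated if every element is a finite sum of units (the empty sum being $0$). *)

theory Defs
  imports "HOL-Algebra.Ring"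
begin

locale idempotent_semiring = semiring R + comm_monoid R for R (structure) +
  assumes add_idem: "x \<in> carrier R \<Longrightarrow> x \<oplus> x = x"

definition canonical_le :: "('a, 'm) ring_scheme \<Rightarrow> 'a \<Rightarrow> 'a \<Rightarrow> bool"
  where "canonical_le R x y \<longleftrightarrow> x \<oplus>\<^bsub>R\<^esub> y = y"

locale idempotent_semifield = idempotent_semiring R for R (structure) +
  assumes zero_neq_one: "\<zero> \<noteq> \<one>"
    and nonzero_unit: "\<lbrakk>x \<in> carrier R; x \<noteq> \<zero>\<rbrakk> \<Longrightarrow> x \<in> Units R"

locale totally_ordered_idempotent_semifield = idempotent_semifield R for R (structure) +
  assumes canonical_le_total:
    "\<lbrakk>x \<in> carrier R; y \<in> carrier R\<rbrakk> \<Longrightarrow> canonical_le R x y \<or> canonical_le R y x"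

definition unitgenerated :: "('a, 'm) ring_scheme \<Rightarrow> bool"
  where "unitgenerated R \<longleftrightarrow>
    (\<forall>x\<in>carrier R. \<exists>(n::nat) u. u \<in> {..<n} \<rightarrow> Units R \<and> x = finsum R u {..<n})"

text \<open>The library's \<^const>\<open>ring_hom\<close> does not require \<open>0\<close> to be preserved; for semirings
  this is not automatic.\<close>

definition semiring_hom :: "('a, 'm) ring_scheme \<Rightarrow> ('b, 'n) ring_scheme \<Rightarrow> ('a \<Rightarrow> 'b) set"
  where "semiring_hom R S = {h \<in> ring_hom R S. h \<zero>\<^bsub>R\<^esub> = \<zero>\<^bsub>S\<^esub>}"

text \<open>Both structures are on the same type, so the inclusion is the identity on the carrier
  of \<open>K\<close>. Operations of \<open>K\<close> need not agree with those of \<open>L\<close> outside that carrier.\<close>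

definition is_subsemiring :: "('a, 'm) ring_scheme \<Rightarrow> ('a, 'n) ring_scheme \<Rightarrow> bool"
  where "is_subsemiring K L \<longleftrightarrow>
    semiring K \<and> semiring L \<and> carrier K \<subseteq> carrier L \<and>
    \<zero>\<^bsub>K\<^esub> = \<zero>\<^bsub>L\<^esub> \<and> \<one>\<^bsub>K\<^esub> = \<one>\<^bsub>L\<^esub> \<and>
    (\<forall>x\<in>carrier K. \<forall>y\<in>carrier K. x \<oplus>\<^bsub>K\<^esub> y = x \<oplus>\<^bsub>L\<^esub> y \<and> x \<otimes>\<^bsub>K\<^esub> y = x \<otimes>\<^bsub>L\<^esub> y)"

end

theory Submission imports Defs
begin

text \<open>
  A homomorphism \<open>w\<close> from \<open>L\<close> to a totally ordered idempotent semifield is determined, up to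
  the choice of the target, by the down-closed subsemiring \<open>T = {x. w x \<le> 1}\<close>, which contains
  every unit or its inverse. As for valuation rings, Zorn's lemma provides a maximal down-closed
  subsemiring \<open>T\<close> that contains every \<open>k \<in> K\<close> with \<open>v k \<le> 1\<close> but no unit \<open>u\<close> of \<open>K\<close> with
  \<open>v u > 1\<close>. If neither \<open>g\<close> nor its inverse \<open>h\<close> were in \<open>T\<close>, then adjoining either of them would
  give \<open>u \<le> t (1 + g)^n\<close> and \<open>u \<le> t (1 + h)^m\<close> for such a \<open>u\<close> and some \<open>t \<in> T\<close>. Since \<open>1 + g\<close>
  and \<open>1 + h\<close> have infimum 1, so do their powers; hence \<open>u \<le> t\<close> would lie in \<open>T\<close>.
\<close>

section \<open>Order arithmetic in idempotent semirings\<close>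

context idempotent_semiring
begin

abbreviation cle (infix "\<preceq>" 50)
  where "x \<preceq> y \<equiv> canonical_le R x y"

lemma cle_refl: "x \<in> carrier R \<Longrightarrow> x \<preceq> x"
  by (simp add: canonical_le_def add_idem)

lemma cle_trans:
  assumes "x \<preceq> y" "y \<preceq> z" "x \<in> carrier R" "y \<in> carrier R" "z \<in> carrier R"
  shows "x \<preceq> z"
  using assms unfolding canonical_le_def by (metis a_assoc)

lemma cle_antisym:
  assumes "x \<preceq> y" "y \<preceq> x" "x \<in> carrier R" "y \<in> carrier R"
  shows "x = y"
  using assms unfolding canonical_le_def by (metis a_comm)

lemma zero_cle: "x \<in> carrier R \<Longrightarrow> \<zero> \<preceq> x"
  by (simp add: canonical_le_def)

lemma cle_add1:
  assumes "x \<in> carrier R" "y \<in> carrier R"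
  shows "x \<preceq> x \<oplus> y"
  using assms by (simp add: canonical_le_def add_idem flip: a_assoc)

lemma cle_add2:
  assumes "x \<in> carrier R" "y \<in> carrier R"
  shows "y \<preceq> x \<oplus> y"
  using cle_add1[of y x] assms by (simp add: a_comm)

lemma add_cleI:
  assumes "x \<preceq> z" "y \<preceq> z" "x \<in> carrier R" "y \<in> carrier R" "z \<in> carrier R"
  shows "x \<oplus> y \<preceq> z"
  using assms by (simp add: canonical_le_def a_assoc)

lemma add_cle_mono:
  assumes "x \<preceq> x'" "y \<preceq> y'"
    and "x \<in> carrier R" "y \<in> carrier R" "x' \<in> carrier R" "y' \<in> carrier R"
  shows "x \<oplus> y \<preceq> x' \<oplus> y'"
  using assms by (meson add_cleI a_closed cle_add1 cle_add2 cle_trans)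

lemma mult_cle_right:
  assumes "x \<preceq> y" "x \<in> carrier R" "y \<in> carrier R" "z \<in> carrier R"
  shows "x \<otimes> z \<preceq> y \<otimes> z"
  using assms unfolding canonical_le_def by (metis l_distr)

lemma mult_cle_left:
  assumes "x \<preceq> y" "x \<in> carrier R" "y \<in> carrier R" "z \<in> carrier R"
  shows "z \<otimes> x \<preceq> z \<otimes> y"
  using assms unfolding canonical_le_def by (metis r_distr)

lemma mult_cle_mono:
  assumes "x \<preceq> x'" "y \<preceq> y'"
    and "x \<in> carrier R" "y \<in> carrier R" "x' \<in> carrier R" "y' \<in> carrier R"
  shows "x \<otimes> y \<preceq> x' \<otimes> y'"
  using assms by (meson mult_cle_left mult_cle_right m_closed cle_trans)

lemma one_cle_pow:
  assumes "\<one> \<preceq> a" "a \<in> carrier R"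
  shows "\<one> \<preceq> a [^] (n::nat)"
proof (induction n)
  case 0
  show ?case by (simp add: cle_refl)
next
  case (Suc n)
  have "\<one> \<otimes> \<one> \<preceq> a [^] n \<otimes> a"
    using Suc assms by (intro mult_cle_mono) auto
  then show ?case by simp
qed

text \<open>For elements above 1 in an idempotent semifield, \<open>ab <= a + b\<close> says without
  division that \<open>a\<close> and \<open>b\<close> have infimum 1, since the infimum is
  \<open>ab/(a + b)\<close>. One more factor \<open>a\<close> is harmless:
  \<open>a^(n+1) b <= a^n (a + b) = a^(n+1) + a^n b\<close>, and the induction hypothesis bounds the
  last summand by \<open>a^n + b\<close>.\<close>

lemma pow_mult_cle:
  assumes ab: "a \<otimes> b \<preceq> a \<oplus> b" and a: "\<one> \<preceq> a"
    and [simp]: "a \<in> carrier R" "b \<in> carrier R"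
  shows "a [^] (n::nat) \<otimes> b \<preceq> a [^] n \<oplus> b"
proof (induction n)
  case 0
  show ?case by (simp add: cle_add2)
next
  case (Suc n)
  have le: "a [^] n \<preceq> a [^] Suc n"
    using mult_cle_left[OF a, of "a [^] n"] by simp
  have "a [^] n \<otimes> (a \<otimes> b) \<preceq> a [^] n \<otimes> (a \<oplus> b)"
    by (intro mult_cle_left ab) auto
  then have 1: "a [^] Suc n \<otimes> b \<preceq> a [^] Suc n \<oplus> a [^] n \<otimes> b"
    by (simp add: m_assoc r_distr)
  have "a [^] n \<oplus> b \<preceq> a [^] Suc n \<oplus> b"
    by (rule add_cle_mono[OF le cle_refl]) auto
  then have "a [^] n \<otimes> b \<preceq> a [^] Suc n \<oplus> b"
    by (rule cle_trans[OF Suc]) auto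
  then have "a [^] Suc n \<oplus> a [^] n \<otimes> b \<preceq> a [^] Suc n \<oplus> b"
    by (intro add_cleI cle_add1) auto
  with 1 show ?case
    by (rule cle_trans) auto
qed

text \<open>The conclusion of \<open>pow_mult_cle\<close> for \<open>a\<close> and \<open>b\<close>
  is again its hypothesis, now for the pair \<open>b\<close> and \<open>a^n\<close>; a second
  application raises the other factor.\<close>

lemma pow_mult_pow_cle:
  assumes ab: "a \<otimes> b \<preceq> a \<oplus> b" and "\<one> \<preceq> a" "\<one> \<preceq> b"
    and [simp]: "a \<in> carrier R" "b \<in> carrier R"
  shows "a [^] (n::nat) \<otimes> b [^] (m::nat) \<preceq> a [^] n \<oplus> b [^] m"
proof -
  have "a [^] n \<otimes> b \<preceq> a [^] n \<oplus> b"
    by (intro pow_mult_cle assms)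
  then have "b [^] m \<otimes> a [^] n \<preceq> b [^] m \<oplus> a [^] n"
    using assms by (intro pow_mult_cle) (simp_all add: m_comm a_comm)
  then show ?thesis by (simp add: m_comm a_comm)
qed

text \<open>Let \<open>A\<close> and \<open>B\<close> be the two powers. Multiplying each bound on
  \<open>c\<close> by the power from the other bound and adding gives
  \<open>c(A + B) <= (t + s)AB <= (t + s)(A + B)\<close>, and the unit \<open>A + B\<close>
  cancels.\<close>

lemma cle_add_of_cle_mult_pow:
  assumes g: "g \<in> Units R"
    and c: "c \<in> carrier R" and t: "t \<in> carrier R" and s: "s \<in> carrier R"
    and unit: "(\<one> \<oplus> g) [^] (n::nat) \<oplus> (\<one> \<oplus> inv g) [^] (m::nat) \<in> Units R"
    and ct: "c \<preceq> t \<otimes> (\<one> \<oplus> g) [^] n"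
    and cs: "c \<preceq> s \<otimes> (\<one> \<oplus> inv g) [^] m"
  shows "c \<preceq> t \<oplus> s"
proof -
  define a where "a = \<one> \<oplus> g"
  define b where "b = \<one> \<oplus> inv g"
  define A where "A = a [^] n"
  define B where "B = b [^] m"
  have [simp]: "g \<in> carrier R" "inv g \<in> carrier R"
    using g by auto
  have [simp]: "a \<in> carrier R" "b \<in> carrier R"
    by (simp_all add: a_def b_def)
  have [simp]: "A \<in> carrier R" "B \<in> carrier R"
    by (simp_all add: A_def B_def)
  note [simp] = c t s
  \<comment> \<open>Here the inverse enters: the product of \<open>g\<close> and
    \<open>inv g\<close> is 1, so expanding \<open>ab\<close> leaves precisely the summands of
    \<open>a + b\<close>.\<close>
  have "a \<otimes> b = (\<one> \<oplus> inv g) \<oplus> (g \<oplus> \<one>)"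
    using g by (simp add: a_def b_def l_distr r_distr a_ac)
  also have "\<dots> = a \<oplus> b"
    by (simp add: a_def b_def a_ac)
  finally have ab: "a \<otimes> b \<preceq> a \<oplus> b"
    by (simp add: cle_refl)
  have "\<one> \<preceq> a" "\<one> \<preceq> b"
    by (simp_all add: a_def b_def cle_add1)
  with ab have AB: "A \<otimes> B \<preceq> A \<oplus> B"
    unfolding A_def B_def by (intro pow_mult_pow_cle) auto
  have 1: "c \<otimes> B \<preceq> t \<otimes> (A \<otimes> B)"
    using mult_cle_right[OF ct, of B] by (simp add: m_assoc flip: a_def A_def)
  have 2: "c \<otimes> A \<preceq> s \<otimes> (A \<otimes> B)"
    using mult_cle_right[OF cs, of A]
    by (simp add: m_assoc m_comm[of A] flip: b_def B_def)
  have "c \<otimes> B \<oplus> c \<otimes> A \<preceq> t \<otimes> (A \<otimes> B) \<oplus> s \<otimes> (A \<otimes> B)"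
    by (intro add_cle_mono 1 2) auto
  then have "c \<otimes> (A \<oplus> B) \<preceq> (t \<oplus> s) \<otimes> (A \<otimes> B)"
    by (simp add: l_distr r_distr a_comm)
  moreover have "\<dots> \<preceq> (t \<oplus> s) \<otimes> (A \<oplus> B)"
    by (intro mult_cle_left AB) auto
  ultimately have "c \<otimes> (A \<oplus> B) \<preceq> (t \<oplus> s) \<otimes> (A \<oplus> B)"
    by (rule cle_trans) auto
  moreover have D: "A \<oplus> B \<in> Units R"
    using unit by (simp add: A_def B_def a_def b_def)
  ultimately have "c \<otimes> (A \<oplus> B) \<otimes> inv (A \<oplus> B) \<preceq> (t \<oplus> s) \<otimes> (A \<oplus> B) \<otimes> inv (A \<oplus> B)"
    by (auto intro: mult_cle_right)
  with D show ?thesis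
    by (simp add: m_assoc)
qed

end

section \<open>Convex subsemirings and their maximal extensions\<close>

text \<open>The analogue of a subring on the way to a valuation ring. Membership of 0 comes from
  \<open>down_mem\<close>, because 0 lies below 1.\<close>

locale convex_subsemiring = idempotent_semiring R for R (structure) +
  fixes T
  assumes subset: "T \<subseteq> carrier R"
    and one_mem: "\<one> \<in> T"
    and add_mem: "\<lbrakk>x \<in> T; y \<in> T\<rbrakk> \<Longrightarrow> x \<oplus> y \<in> T"
    and mult_mem: "\<lbrakk>x \<in> T; y \<in> T\<rbrakk> \<Longrightarrow> x \<otimes> y \<in> T"
    and down_mem: "\<lbrakk>x \<in> carrier R; x \<preceq> y; y \<in> T\<rbrakk> \<Longrightarrow> x \<in> T"
begin

lemma mem_carrier: "x \<in> T \<Longrightarrow> x \<in> carrier R"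
  using subset by blast

text \<open>\<open>T'\<close> is the least convex subsemiring containing \<open>T\<close> and
  \<open>g\<close>. Since \<open>(1 + g)^n\<close> dominates \<open>g^0, ..., g^n\<close>, a
  polynomial in \<open>g\<close> over \<open>T\<close> is bounded by one coefficient, the sum of its
  coefficients, times one such power.\<close>

lemma adjoin:
  assumes [simp]: "g \<in> carrier R"
  defines "T' \<equiv> {x \<in> carrier R. \<exists>t\<in>T. \<exists>n::nat. x \<preceq> t \<otimes> (\<one> \<oplus> g) [^] n}"
  shows "convex_subsemiring R T'" and "T \<subseteq> T'" and "g \<in> T'"
proof -
  define a where "a = \<one> \<oplus> g"
  have [simp]: "a \<in> carrier R" by (simp add: a_def)
  have a1: "\<one> \<preceq> a" by (simp add: a_def cle_add1)
  have T': "T' = {x \<in> carrier R. \<exists>t\<in>T. \<exists>n::nat. x \<preceq> t \<otimes> a [^] n}"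
    by (simp add: T'_def a_def)
  note [simp] = mem_carrier
  show sub: "T \<subseteq> T'"
  proof
    fix x assume "x \<in> T"
    then have "x \<in> carrier R" "x \<preceq> x \<otimes> a [^] (0::nat)"
      by (auto intro: cle_refl)
    with \<open>x \<in> T\<close> show "x \<in> T'" unfolding T' by blast
  qed
  have "g \<preceq> \<one> \<otimes> a [^] (1::nat)"
    by (simp add: a_def cle_add2)
  then show "g \<in> T'" unfolding T' using one_mem assms(1) by blast
  show "convex_subsemiring R T'"
  proof unfold_locales
    show "T' \<subseteq> carrier R" unfolding T' by blast
    show "\<one> \<in> T'" using sub one_mem by blast
  next
    fix x y assume "x \<in> T'" "y \<in> T'"
    then obtain t s n m where ts [simp]: "t \<in> T" "s \<in> T"
      and [simp]: "x \<in> carrier R" "y \<in> carrier R"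
      and x: "x \<preceq> t \<otimes> a [^] (n::nat)" and y: "y \<preceq> s \<otimes> a [^] (m::nat)"
      unfolding T' by blast
    \<comment> \<open>Powers of \<open>a\<close> increase because 1 is below \<open>a\<close>; the
      exponent \<open>n + m\<close> therefore serves both bounds at once, and it is also the
      exponent that the product produces.\<close>
    have "a [^] n \<otimes> \<one> \<preceq> a [^] n \<otimes> a [^] m"
      by (intro mult_cle_left one_cle_pow a1) auto
    then have n: "a [^] n \<preceq> a [^] (n + m)" by (simp add: nat_pow_mult)
    have "\<one> \<otimes> a [^] m \<preceq> a [^] n \<otimes> a [^] m"
      by (intro mult_cle_right one_cle_pow a1) auto
    then have m: "a [^] m \<preceq> a [^] (n + m)" by (simp add: nat_pow_mult)
    have "x \<preceq> (t \<oplus> s) \<otimes> a [^] (n + m)"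
      by (rule cle_trans[OF x mult_cle_mono[OF cle_add1 n]]) auto
    moreover have "y \<preceq> (t \<oplus> s) \<otimes> a [^] (n + m)"
      by (rule cle_trans[OF y mult_cle_mono[OF cle_add2 m]]) auto
    ultimately have "x \<oplus> y \<preceq> (t \<oplus> s) \<otimes> a [^] (n + m)"
      by (intro add_cleI) auto
    moreover have "t \<oplus> s \<in> T" by (simp add: add_mem)
    ultimately show "x \<oplus> y \<in> T'" unfolding T' by auto
    have "x \<otimes> y \<preceq> (t \<otimes> a [^] n) \<otimes> (s \<otimes> a [^] m)"
      by (intro mult_cle_mono x y) auto
    also have "(t \<otimes> a [^] n) \<otimes> (s \<otimes> a [^] m) = (t \<otimes> s) \<otimes> (a [^] n \<otimes> a [^] m)"
      by (simp add: m_ac)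
    finally have "x \<otimes> y \<preceq> (t \<otimes> s) \<otimes> a [^] (n + m)"
      by (simp add: nat_pow_mult)
    moreover have "t \<otimes> s \<in> T" by (simp add: mult_mem)
    ultimately show "x \<otimes> y \<in> T'" unfolding T' by auto
  next
    fix x y assume "x \<in> carrier R" "x \<preceq> y" "y \<in> T'"
    then show "x \<in> T'"
      unfolding T' using cle_trans[of x y] mem_carrier
      by (smt (verit, best) \<open>a \<in> carrier R\<close> m_closed mem_Collect_eq nat_pow_closed)
  qed
qed

text \<open>Each closure condition involves at most two members of the union, and a chain puts these
  into one common set.\<close>

lemma Union_chain:
  assumes "C \<noteq> {}" and "subset.chain {X. convex_subsemiring R X} C"
  shows "convex_subsemiring R (\<Union>C)"
proof -
  have conv: "convex_subsemiring R X" if "X \<in> C" for X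
    using assms that by (auto simp: subset.chain_def)
  have pair: "\<exists>X\<in>C. x \<in> X \<and> y \<in> X" if "x \<in> \<Union>C" "y \<in> \<Union>C" for x y
  proof -
    from that obtain X Y where XY: "X \<in> C" "Y \<in> C" "x \<in> X" "y \<in> Y" by blast
    then have "X \<subseteq> Y \<or> Y \<subseteq> X" using subset.chain_total[OF assms(2)] by blast
    with XY show ?thesis by blast
  qed
  show ?thesis
  proof unfold_locales
    show "\<Union>C \<subseteq> carrier R" using conv convex_subsemiring.subset by blast
    show "\<one> \<in> \<Union>C" using conv convex_subsemiring.one_mem \<open>C \<noteq> {}\<close> by blast
    show "x \<oplus> y \<in> \<Union>C" "x \<otimes> y \<in> \<Union>C" if "x \<in> \<Union>C" "y \<in> \<Union>C" for x y
      using pair[OF that] conv convex_subsemiring.add_mem convex_subsemiring.mult_mem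
      by (metis UnionI)+
    show "x \<in> \<Union>C" if "x \<in> carrier R" "x \<preceq> y" "y \<in> \<Union>C" for x y
      using that conv convex_subsemiring.down_mem by (metis UnionE UnionI)
  qed
qed

text \<open>The comparability assumption on \<open>S\<close> allows both adjunctions to be tested against the
  same element of \<open>S\<close>.\<close>

lemma exists_total_extension:
  assumes L: "idempotent_semifield R"
    and S: "S \<subseteq> carrier R" "T \<inter> S = {}"
    and cmp: "\<And>x y. \<lbrakk>x \<in> S; y \<in> S\<rbrakk> \<Longrightarrow> (\<exists>t\<in>T. x = t \<otimes> y) \<or> (\<exists>t\<in>T. y = t \<otimes> x)"
  obtains M where "convex_subsemiring R M" "T \<subseteq> M" "M \<inter> S = {}"
    "\<And>g. g \<in> Units R \<Longrightarrow> g \<in> M \<or> inv g \<in> M"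
proof -
  interpret L: idempotent_semifield R by (rule L)
  define \<A> where "\<A> = {X. convex_subsemiring R X \<and> T \<subseteq> X \<and> X \<inter> S = {}}"
  have "\<exists>M\<in>\<A>. \<forall>X\<in>\<A>. M \<subseteq> X \<longrightarrow> X = M"
  proof (rule subset_Zorn_nonempty)
    show "\<A> \<noteq> {}" using S convex_subsemiring_axioms by (auto simp: \<A>_def)
    fix C assume C: "C \<noteq> {}" "subset.chain \<A> C"
    then have "subset.chain {X. convex_subsemiring R X} C"
      by (auto simp: subset.chain_def \<A>_def)
    from Union_chain[OF C(1) this] show "\<Union>C \<in> \<A>"
      using C by (auto simp: subset.chain_def \<A>_def)
  qed
  then obtain M where M: "M \<in> \<A>" and max: "\<And>X. X \<in> \<A> \<Longrightarrow> M \<subseteq> X \<Longrightarrow> X = M"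
    by blast
  interpret M: convex_subsemiring R M using M by (simp add: \<A>_def)
  have TM: "T \<subseteq> M" and MS: "M \<inter> S = {}" using M by (auto simp: \<A>_def)
  \<comment> \<open>Adjoining \<open>g\<close> enlarges \<open>M\<close> strictly, so by maximality
    the result can no longer avoid \<open>S\<close>.\<close>
  have meets: "\<exists>c\<in>S. \<exists>t\<in>M. \<exists>n::nat. c \<preceq> t \<otimes> (\<one> \<oplus> g) [^] n"
    if "g \<in> carrier R" "g \<notin> M" for g
  proof (rule ccontr)
    assume no: "\<not> ?thesis"
    let ?T' = "{x \<in> carrier R. \<exists>t\<in>M. \<exists>n::nat. x \<preceq> t \<otimes> (\<one> \<oplus> g) [^] n}"
    from M.adjoin[OF that(1)] no TM have "?T' \<in> \<A>" by (auto simp: \<A>_def)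
    from max[OF this] M.adjoin[OF that(1)] that(2) show False by blast
  qed
  have no_common: False
    if g: "g \<in> Units R" and "c \<in> S" "t \<in> M" "s \<in> M"
      and ct: "c \<preceq> t \<otimes> (\<one> \<oplus> g) [^] (n::nat)"
      and cs: "c \<preceq> s \<otimes> (\<one> \<oplus> inv g) [^] (m::nat)" for g c t s n m
  proof -
    \<comment> \<open>This sum lies above 1, whereas 1 below 0 would mean 1 = 0; so it is nonzero
      and the semifield makes it invertible.\<close>
    have "(\<one> \<oplus> g) [^] n \<oplus> (\<one> \<oplus> inv g) [^] m \<in> Units R"
    proof (rule L.nonzero_unit)
      let ?x = "(\<one> \<oplus> g) [^] n" and ?y = "(\<one> \<oplus> inv g) [^] m"
      have car: "?x \<in> carrier R" "?y \<in> carrier R" using g by auto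
      then show "?x \<oplus> ?y \<in> carrier R" by simp
      have "\<one> \<preceq> ?x" using g by (intro one_cle_pow cle_add1) auto
      then have "\<one> \<preceq> ?x \<oplus> ?y"
        using cle_trans[OF _ cle_add1] car by simp
      then show "?x \<oplus> ?y \<noteq> \<zero>"
        using L.zero_neq_one by (auto simp: canonical_le_def)
    qed
    with that have "c \<preceq> t \<oplus> s"
      using S M.mem_carrier by (intro cle_add_of_cle_mult_pow[OF g]) auto
    then have "c \<in> M"
      using that S M.add_mem M.down_mem by blast
    with MS \<open>c \<in> S\<close> show False by blast
  qed
  \<comment> \<open>The factor \<open>t\<close> from \<open>T\<close> is absorbed into the
    coefficient, so a bound for \<open>d\<close> becomes a bound for \<open>c\<close> with the same
    power \<open>x\<close>.\<close>
  have transfer: "\<exists>t'\<in>M. c \<preceq> t' \<otimes> x"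
    if "c = t \<otimes> d" "t \<in> T" "d \<in> S" "s \<in> M" "x \<in> carrier R" "d \<preceq> s \<otimes> x" for c d t s x
  proof
    have car: "t \<in> carrier R" "d \<in> carrier R" "s \<in> carrier R"
      using that S M.mem_carrier TM by auto
    show "t \<otimes> s \<in> M" using that TM M.mult_mem by blast
    show "c \<preceq> t \<otimes> s \<otimes> x"
      using mult_cle_left[OF that(6), of t] car that by (simp add: m_assoc)
  qed
  have "g \<in> M \<or> inv g \<in> M" if g: "g \<in> Units R" for g
  proof (rule ccontr)
    assume "\<not> ?thesis"
    then obtain c d t s n m where cd: "c \<in> S" "d \<in> S" and ts: "t \<in> M" "s \<in> M"
      and c: "c \<preceq> t \<otimes> (\<one> \<oplus> g) [^] (n::nat)" and d: "d \<preceq> s \<otimes> (\<one> \<oplus> inv g) [^] (m::nat)"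
      using meets[of g] meets[of "inv g"] g by blast
    have car: "(\<one> \<oplus> g) [^] n \<in> carrier R" "(\<one> \<oplus> inv g) [^] m \<in> carrier R"
      using g by auto
    from cmp[OF cd] show False
    proof
      assume "\<exists>r\<in>T. c = r \<otimes> d"
      with transfer[OF _ _ cd(2) ts(2) car(2) d] show False
        using no_common[OF g cd(1) ts(1) _ c] by blast
    next
      assume "\<exists>r\<in>T. d = r \<otimes> c"
      with transfer[OF _ _ cd(1) ts(1) car(1) c] show False
        using no_common[OF g cd(2) _ ts(2) _ d] by blast
    qed
  qed
  with that TM MS M.convex_subsemiring_axioms show ?thesis by blast
qed

section \<open>The quotient by a convex subsemiring\<close>

text \<open>For a unit \<open>y\<close> this amounts to \<open>x/y\<close> lying in
  \<open>T\<close>, by down-closure; the division-free form also covers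
  \<open>y = 0\<close>.\<close>

definition preorder_of :: "'a \<Rightarrow> 'a \<Rightarrow> bool"
  where "preorder_of x y \<longleftrightarrow> (\<exists>t\<in>T. x \<preceq> t \<otimes> y)"

lemma preorder_ofI: "\<lbrakk>x \<preceq> y; y \<in> carrier R\<rbrakk> \<Longrightarrow> preorder_of x y"
  unfolding preorder_of_def using one_mem by (metis l_one)

lemma preorder_of_trans:
  assumes "preorder_of x y" "preorder_of y z"
    and [simp]: "x \<in> carrier R" "y \<in> carrier R" "z \<in> carrier R"
  shows "preorder_of x z"
proof -
  obtain t s where ts: "t \<in> T" "s \<in> T" and x: "x \<preceq> t \<otimes> y" and y: "y \<preceq> s \<otimes> z"
    using assms by (auto simp: preorder_of_def)
  have [simp]: "t \<in> carrier R" "s \<in> carrier R" using ts by (auto simp: mem_carrier)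
  have "x \<preceq> t \<otimes> (s \<otimes> z)"
    by (rule cle_trans[OF x mult_cle_left[OF y]]) auto
  then have "x \<preceq> (t \<otimes> s) \<otimes> z" by (simp add: m_assoc)
  with mult_mem[OF ts] show ?thesis unfolding preorder_of_def by blast
qed

lemma preorder_of_add:
  assumes "preorder_of x x'" "preorder_of y y'"
    and [simp]: "x \<in> carrier R" "y \<in> carrier R" "x' \<in> carrier R" "y' \<in> carrier R"
  shows "preorder_of (x \<oplus> y) (x' \<oplus> y')"
proof -
  obtain t s where ts: "t \<in> T" "s \<in> T" and x: "x \<preceq> t \<otimes> x'" and y: "y \<preceq> s \<otimes> y'"
    using assms by (auto simp: preorder_of_def)
  have [simp]: "t \<in> carrier R" "s \<in> carrier R" using ts by (auto simp: mem_carrier)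
  have "x \<preceq> (t \<oplus> s) \<otimes> (x' \<oplus> y')"
    by (rule cle_trans[OF x mult_cle_mono]) (auto intro: cle_add1)
  moreover have "y \<preceq> (t \<oplus> s) \<otimes> (x' \<oplus> y')"
    by (rule cle_trans[OF y mult_cle_mono]) (auto intro: cle_add2)
  ultimately show ?thesis
    using add_mem[OF ts] unfolding preorder_of_def by (intro bexI[of _ "t \<oplus> s"] add_cleI) auto
qed

lemma preorder_of_mult:
  assumes "preorder_of x x'" "preorder_of y y'"
    and [simp]: "x \<in> carrier R" "y \<in> carrier R" "x' \<in> carrier R" "y' \<in> carrier R"
  shows "preorder_of (x \<otimes> y) (x' \<otimes> y')"
proof -
  obtain t s where ts: "t \<in> T" "s \<in> T" and x: "x \<preceq> t \<otimes> x'" and y: "y \<preceq> s \<otimes> y'"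
    using assms by (auto simp: preorder_of_def)
  have [simp]: "t \<in> carrier R" "s \<in> carrier R" using ts by (auto simp: mem_carrier)
  have "x \<otimes> y \<preceq> (t \<otimes> x') \<otimes> (s \<otimes> y')"
    by (intro mult_cle_mono x y) auto
  then have "x \<otimes> y \<preceq> (t \<otimes> s) \<otimes> (x' \<otimes> y')" by (simp add: m_ac)
  with mult_mem[OF ts] show ?thesis unfolding preorder_of_def by blast
qed

text \<open>In the analogy with valuation rings this is the value of \<open>x\<close>, not an
  element of a residue field.\<close>

definition residue_class :: "'a \<Rightarrow> 'a set"
  where "residue_class x = {y \<in> carrier R. preorder_of x y \<and> preorder_of y x}"

lemma residue_class_eq_iff:
  assumes "x \<in> carrier R" "y \<in> carrier R"
  shows "residue_class x = residue_class y \<longleftrightarrow> preorder_of x y \<and> preorder_of y x"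
proof
  assume "residue_class x = residue_class y"
  moreover have "x \<in> residue_class x"
    using assms by (simp add: residue_class_def preorder_ofI cle_refl)
  ultimately show "preorder_of x y \<and> preorder_of y x" by (auto simp: residue_class_def)
next
  assume "preorder_of x y \<and> preorder_of y x"
  then show "residue_class x = residue_class y"
    using assms preorder_of_trans unfolding residue_class_def by blast
qed

end

text \<open>The quotient of \<open>R\<close> by the kernel relation of \<open>h\<close>, realised on
  the image. The operations use representatives chosen by \<open>inv_into\<close>; they are
  independent of that choice exactly when the relation is a congruence.\<close>

definition image_structure :: "('a, 'm) ring_scheme \<Rightarrow> ('a \<Rightarrow> 'b) \<Rightarrow> 'b ring"
  where "image_structure R h =
    \<lparr>carrier = h ` carrier R,
     mult = (\<lambda>a b. h (inv_into (carrier R) h a \<otimes>\<^bsub>R\<^esub> inv_into (carrier R) h b)),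
     one = h \<one>\<^bsub>R\<^esub>, zero = h \<zero>\<^bsub>R\<^esub>,
     add = (\<lambda>a b. h (inv_into (carrier R) h a \<oplus>\<^bsub>R\<^esub> inv_into (carrier R) h b))\<rparr>"

text \<open>The congruence hypothesis lets any representatives replace the chosen ones, so each
  semiring law is the image under \<open>h\<close> of the same law in \<open>R\<close>.\<close>

lemma (in idempotent_semiring) image_structure:
  assumes "\<And>x x' y y'. \<lbrakk>x \<in> carrier R; x' \<in> carrier R; y \<in> carrier R; y' \<in> carrier R;
      h x = h x'; h y = h y'\<rbrakk> \<Longrightarrow> h (x \<oplus> y) = h (x' \<oplus> y') \<and> h (x \<otimes> y) = h (x' \<otimes> y')"
  shows "idempotent_semiring (image_structure R h)"
    and "h \<in> semiring_hom R (image_structure R h)"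
proof -
  let ?F = "image_structure R h"
  have carr: "carrier ?F = h ` carrier R" and one: "\<one>\<^bsub>?F\<^esub> = h \<one>" and zero: "\<zero>\<^bsub>?F\<^esub> = h \<zero>"
    by (simp_all add: image_structure_def)
  have add: "h x \<oplus>\<^bsub>?F\<^esub> h y = h (x \<oplus> y)" and mult: "h x \<otimes>\<^bsub>?F\<^esub> h y = h (x \<otimes> y)"
    if "x \<in> carrier R" "y \<in> carrier R" for x y
    using assms[of "inv_into (carrier R) h (h x)" x "inv_into (carrier R) h (h y)" y] that
    by (simp_all add: image_structure_def inv_into_into f_inv_into_f)
  show "h \<in> semiring_hom R ?F"
    by (auto simp: semiring_hom_def ring_hom_def carr one zero add mult)
  show "idempotent_semiring ?F"
    by unfold_locales
      (auto simp: carr one zero add mult add_idem l_distr r_distr a_ac m_ac)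
qed

text \<open>Nonzero elements of \<open>R\<close> are units, so comparing nonzero \<open>x\<close>
  and \<open>y\<close> reduces to asking whether \<open>x/y\<close> or its inverse lies in
  \<open>T\<close>, which \<open>total\<close> decides.\<close>

lemma (in convex_subsemiring) total_quotient:
  assumes L: "idempotent_semifield R"
    and total: "\<And>g. g \<in> Units R \<Longrightarrow> g \<in> T \<or> inv g \<in> T"
  shows "totally_ordered_idempotent_semifield (image_structure R residue_class)"
    and "residue_class \<in> semiring_hom R (image_structure R residue_class)"
proof -
  interpret L: idempotent_semifield R by (rule L)
  note [simp] = Units_closed
  let ?F = "image_structure R residue_class"
  have cong: "residue_class (x \<oplus> y) = residue_class (x' \<oplus> y') \<and> residue_class (x \<otimes> y) = residue_class (x' \<otimes> y')"
    if "x \<in> carrier R" "x' \<in> carrier R" "y \<in> carrier R" "y' \<in> carrier R"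
      "residue_class x = residue_class x'" "residue_class y = residue_class y'" for x x' y y'
    using that by (simp add: residue_class_eq_iff preorder_of_add preorder_of_mult)
  interpret F: idempotent_semiring ?F using cong by (rule image_structure)
  show hom: "residue_class \<in> semiring_hom R ?F" using cong by (rule image_structure)
  have carr: "carrier ?F = residue_class ` carrier R" and one: "\<one>\<^bsub>?F\<^esub> = residue_class \<one>"
    and zero: "\<zero>\<^bsub>?F\<^esub> = residue_class \<zero>"
    by (simp_all add: image_structure_def)
  have add: "residue_class x \<oplus>\<^bsub>?F\<^esub> residue_class y = residue_class (x \<oplus> y)"
    and mult: "residue_class x \<otimes>\<^bsub>?F\<^esub> residue_class y = residue_class (x \<otimes> y)"
    if "x \<in> carrier R" "y \<in> carrier R" for x y
    using hom that by (auto simp: semiring_hom_def ring_hom_def)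
  have le: "canonical_le ?F (residue_class x) (residue_class y)"
    if "preorder_of x y" and [simp]: "x \<in> carrier R" "y \<in> carrier R" for x y
  proof -
    \<comment> \<open>Adding \<open>y\<close> on both sides keeps the preorder, and idempotence
      collapses the right side to \<open>y\<close>.\<close>
    have "preorder_of (x \<oplus> y) (y \<oplus> y)"
      by (simp add: preorder_of_add that preorder_ofI cle_refl)
    moreover have "preorder_of y (x \<oplus> y)"
      by (intro preorder_ofI cle_add2) auto
    ultimately have "residue_class (x \<oplus> y) = residue_class y"
      by (simp add: residue_class_eq_iff add_idem)
    then show ?thesis by (simp add: canonical_le_def add)
  qed
  have quotient: "preorder_of x y"
    if "x \<in> carrier R" "y \<in> Units R" "x \<otimes> inv y \<in> T" for x y
  proof -
    have "x \<preceq> x \<otimes> inv y \<otimes> y" using that by (simp add: m_assoc cle_refl)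
    with that show ?thesis unfolding preorder_of_def by blast
  qed
  have pre_total: "preorder_of x y \<or> preorder_of y x"
    if "x \<in> carrier R" "y \<in> carrier R" for x y
  proof (cases "x = \<zero> \<or> y = \<zero>")
    case True
    then show ?thesis using that by (auto intro: preorder_ofI zero_cle)
  next
    case False
    then have x: "x \<in> Units R" and y: "y \<in> Units R"
      using that L.nonzero_unit by auto
    have "x \<otimes> inv y \<otimes> (y \<otimes> inv x) = x \<otimes> (inv y \<otimes> y) \<otimes> inv x"
      using x y by (simp add: m_assoc del: Units_l_inv)
    then have "inv (x \<otimes> inv y) = y \<otimes> inv x"
      using x y by (intro comm_inv_char) auto
    moreover have "x \<otimes> inv y \<in> Units R" using x y by simp
    ultimately show ?thesis using total[of "x \<otimes> inv y"] quotient x y by auto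
  qed
  show "totally_ordered_idempotent_semifield ?F"
  proof unfold_locales
    \<comment> \<open>A multiple of 0 is 0, so the preorder would put 1 below 0, that is, 1 =
      0.\<close>
    have "\<not> preorder_of \<one> \<zero>"
      using mem_carrier L.zero_neq_one by (auto simp: preorder_of_def canonical_le_def)
    then show "\<zero>\<^bsub>?F\<^esub> \<noteq> \<one>\<^bsub>?F\<^esub>"
      by (simp add: zero one residue_class_eq_iff)
  next
    fix a assume "a \<in> carrier ?F" "a \<noteq> \<zero>\<^bsub>?F\<^esub>"
    then obtain x where x: "x \<in> carrier R" "x \<noteq> \<zero>" and a: "a = residue_class x"
      by (auto simp: carr zero)
    then have u: "x \<in> Units R" by (intro L.nonzero_unit)
    then have "residue_class (inv x) \<otimes>\<^bsub>?F\<^esub> a = \<one>\<^bsub>?F\<^esub>" "a \<otimes>\<^bsub>?F\<^esub> residue_class (inv x) = \<one>\<^bsub>?F\<^esub>"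
      using x by (simp_all add: a mult one)
    moreover have "residue_class (inv x) \<in> carrier ?F" "a \<in> carrier ?F"
      using u x by (simp_all add: carr a)
    ultimately show "a \<in> Units ?F"
      unfolding Units_def by blast
  next
    fix a b assume "a \<in> carrier ?F" "b \<in> carrier ?F"
    then show "canonical_le ?F a b \<or> canonical_le ?F b a"
      using pre_total le by (auto simp: carr)
  qed
qed

section \<open>Homomorphisms and values of units\<close>

lemma semiring_homD:
  assumes "h \<in> semiring_hom R S"
  shows "x \<in> carrier R \<Longrightarrow> h x \<in> carrier S"
    and "\<lbrakk>x \<in> carrier R; y \<in> carrier R\<rbrakk> \<Longrightarrow> h (x \<oplus>\<^bsub>R\<^esub> y) = h x \<oplus>\<^bsub>S\<^esub> h y"
    and "\<lbrakk>x \<in> carrier R; y \<in> carrier R\<rbrakk> \<Longrightarrow> h (x \<otimes>\<^bsub>R\<^esub> y) = h x \<otimes>\<^bsub>S\<^esub> h y"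
    and "h \<one>\<^bsub>R\<^esub> = \<one>\<^bsub>S\<^esub>" and "h \<zero>\<^bsub>R\<^esub> = \<zero>\<^bsub>S\<^esub>"
  using assms by (auto simp: semiring_hom_def ring_hom_def)

text \<open>In a totally ordered target, a sum of units has the same image as one of its summands.\<close>

lemma unitgenerated_unit_below:
  assumes K: "idempotent_semiring K" "unitgenerated K"
    and E: "totally_ordered_idempotent_semifield E"
    and v: "v \<in> semiring_hom K E"
    and k: "k \<in> carrier K" "k \<noteq> \<zero>\<^bsub>K\<^esub>"
  obtains u where "u \<in> Units K" "canonical_le K u k" "v u = v k"
proof -
  interpret K: idempotent_semiring K by (rule K)
  interpret E: totally_ordered_idempotent_semifield E by (rule E)
  note v = semiring_homD[OF v]
  obtain n :: nat and f where f: "f \<in> {..<n} \<rightarrow> Units K" and sum: "k = finsum K f {..<n}"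
    using K(2) k by (auto simp: unitgenerated_def)
  \<comment> \<open>The induction carries the alternative of a zero sum because it starts from the
    empty sum; \<open>k\<close> being nonzero discards it at the end.\<close>
  have "finsum K f {..<n} = \<zero>\<^bsub>K\<^esub> \<or>
      (\<exists>u\<in>Units K. canonical_le K u (finsum K f {..<n}) \<and> v u = v (finsum K f {..<n}))"
    using f
  proof (induction n)
    case 0
    then show ?case by simp
  next
    case (Suc n)
    let ?s = "finsum K f {..<n}"
    have fn: "f n \<in> Units K" and fc: "f n \<in> carrier K" and fP: "f \<in> {..<n} \<rightarrow> carrier K"
      using Suc.prems by (auto simp: Pi_iff)
    have s: "?s \<in> carrier K" using fP by simp
    have eq: "finsum K f {..<Suc n} = f n \<oplus>\<^bsub>K\<^esub> ?s"
      using fP fc by (simp add: lessThan_Suc K.finsum_insert)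
    have IH: "?s = \<zero>\<^bsub>K\<^esub> \<or> (\<exists>u\<in>Units K. canonical_le K u ?s \<and> v u = v ?s)"
      using Suc by (auto simp: Pi_iff)
    \<comment> \<open>If the new summand dominates in value, it is the witness itself. Otherwise the
      old witness survives: the partial sum cannot be 0, whose value is least in
      \<open>E\<close>.\<close>
    show ?case
    proof (cases "canonical_le E (v ?s) (v (f n))")
      case True
      then have "v (f n \<oplus>\<^bsub>K\<^esub> ?s) = v (f n)"
        using fc s by (simp add: v E.a_comm canonical_le_def)
      moreover have "canonical_le K (f n) (f n \<oplus>\<^bsub>K\<^esub> ?s)"
        using fc s by (rule K.cle_add1)
      ultimately show ?thesis unfolding eq using fn by metis
    next
      case False
      then have "?s \<noteq> \<zero>\<^bsub>K\<^esub>" using fc by (auto simp: v E.zero_cle)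
      with IH obtain u where u: "u \<in> Units K" "canonical_le K u ?s" "v u = v ?s"
        by blast
      have "canonical_le E (v (f n)) (v ?s)"
        using False E.canonical_le_total v(1) fc s by blast
      then have "v u = v (f n \<oplus>\<^bsub>K\<^esub> ?s)"
        using fc s u by (simp add: v canonical_le_def)
      moreover have "canonical_le K u (f n \<oplus>\<^bsub>K\<^esub> ?s)"
        using K.cle_trans[OF u(2) K.cle_add2[OF fc s]] u fc s by (simp add: K.Units_closed)
      ultimately show ?thesis unfolding eq using u by metis
    qed
  qed
  with k sum that show ?thesis by blast
qed

section \<open>Extending \<open>v\<close> from \<open>K\<close> to \<open>L\<close>\<close>

theorem corollary8p13:
  fixes K :: "('a, 'k) ring_scheme" and E :: "('b, 'e) ring_scheme"
    and L :: "('a, 'l) ring_scheme" and v :: "'a \<Rightarrow> 'b" and i :: "'a \<Rightarrow> 'a"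
  assumes "idempotent_semiring K" and "unitgenerated K"
    and "totally_ordered_idempotent_semifield E"
    and "v \<in> semiring_hom K E" and "v ` carrier K = carrier E"
    and "idempotent_semifield L" and "is_subsemiring K L"
    and "\<And>x. x \<in> carrier K \<Longrightarrow> i x = x"
  shows "\<exists>(F :: 'a set ring) j w.
    totally_ordered_idempotent_semifield F \<and>
    j \<in> semiring_hom E F \<and> inj_on j (carrier E) \<and>
    w \<in> semiring_hom L F \<and>
    (\<forall>x\<in>carrier K. (w \<circ> i) x = (j \<circ> v) x)"
proof -
  interpret K: idempotent_semiring K by fact
  interpret E: totally_ordered_idempotent_semifield E by fact
  interpret L: idempotent_semifield L by fact
  note [simp] = K.Units_closed
  note v = semiring_homD[OF assms(4)]
  have KL: "x \<in> carrier K \<Longrightarrow> x \<in> carrier L" for x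
    using assms(7) by (auto simp: is_subsemiring_def)
  have sub: "\<zero>\<^bsub>K\<^esub> = \<zero>\<^bsub>L\<^esub>" "\<one>\<^bsub>K\<^esub> = \<one>\<^bsub>L\<^esub>"
    "\<And>x y. x \<in> carrier K \<Longrightarrow> y \<in> carrier K \<Longrightarrow> x \<oplus>\<^bsub>K\<^esub> y = x \<oplus>\<^bsub>L\<^esub> y"
    "\<And>x y. x \<in> carrier K \<Longrightarrow> y \<in> carrier K \<Longrightarrow> x \<otimes>\<^bsub>K\<^esub> y = x \<otimes>\<^bsub>L\<^esub> y"
    using assms(7) by (auto simp: is_subsemiring_def)
  have le_KL: "canonical_le L x y \<longleftrightarrow> canonical_le K x y"
    if "x \<in> carrier K" "y \<in> carrier K" for x y
    using that by (simp add: canonical_le_def sub)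
  have v_mono: "canonical_le E (v x) (v y)"
    if "canonical_le K x y" "x \<in> carrier K" "y \<in> carrier K" for x y
    using that v(2)[of x y] by (simp add: canonical_le_def)
  have v_inv: "v u \<otimes>\<^bsub>E\<^esub> v (inv\<^bsub>K\<^esub> u) = \<one>\<^bsub>E\<^esub>" if "u \<in> Units K" for u
    using that v(3)[of u "inv\<^bsub>K\<^esub> u"] by (simp add: v(4))
  note unit_below = unitgenerated_unit_below[OF assms(1-4)]
  \<comment> \<open>A nonzero \<open>k\<close> shares its value with a unit, and values of units are
    invertible in \<open>E\<close>.\<close>
  have v_zero: "k = \<zero>\<^bsub>K\<^esub>" if k: "k \<in> carrier K" "v k = \<zero>\<^bsub>E\<^esub>" for k
  proof (rule ccontr)
    assume "k \<noteq> \<zero>\<^bsub>K\<^esub>"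
    then obtain u where "u \<in> Units K" "v u = \<zero>\<^bsub>E\<^esub>"
      using unit_below k by metis
    with v_inv[of u] E.zero_neq_one show False by (simp add: v)
  qed

  \<comment> \<open>The down-closure in \<open>L\<close> of the elements of \<open>K\<close> with
    value at most 1. Any solution \<open>w\<close> sends all of it below 1, so this is the forced
    starting point.\<close>
  define T where "T = {x \<in> carrier L. \<exists>k\<in>carrier K. canonical_le E (v k) \<one>\<^bsub>E\<^esub> \<and> canonical_le L x k}"
  have T_memI: "k \<in> T" if "k \<in> carrier K" "canonical_le E (v k) \<one>\<^bsub>E\<^esub>" for k
    using that KL L.cle_refl unfolding T_def by blast
  have T: "convex_subsemiring L T"
  proof unfold_locales
    show "T \<subseteq> carrier L" by (auto simp: T_def)
    show "\<one>\<^bsub>L\<^esub> \<in> T"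
      using T_memI[of "\<one>\<^bsub>K\<^esub>"] by (simp add: v sub(2) E.cle_refl flip: sub(2))
  next
    fix x y assume "x \<in> T" "y \<in> T"
    then obtain k l where kl: "k \<in> carrier K" "l \<in> carrier K"
      "canonical_le E (v k) \<one>\<^bsub>E\<^esub>" "canonical_le E (v l) \<one>\<^bsub>E\<^esub>"
      and xy: "canonical_le L x k" "canonical_le L y l" "x \<in> carrier L" "y \<in> carrier L"
      by (auto simp: T_def)
    have "canonical_le E (v (k \<oplus>\<^bsub>K\<^esub> l)) \<one>\<^bsub>E\<^esub>"
      using kl by (simp add: v E.add_cleI)
    moreover have "canonical_le L (x \<oplus>\<^bsub>L\<^esub> y) (k \<oplus>\<^bsub>K\<^esub> l)"
      using kl xy by (simp add: sub KL L.add_cle_mono)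
    ultimately show "x \<oplus>\<^bsub>L\<^esub> y \<in> T"
      using kl xy K.a_closed[OF kl(1,2)] L.a_closed unfolding T_def by blast
    have "canonical_le E (v (k \<otimes>\<^bsub>K\<^esub> l)) \<one>\<^bsub>E\<^esub>"
      using kl E.mult_cle_mono[OF kl(3,4)] by (simp add: v)
    moreover have "canonical_le L (x \<otimes>\<^bsub>L\<^esub> y) (k \<otimes>\<^bsub>K\<^esub> l)"
      using kl xy by (simp add: sub KL L.mult_cle_mono)
    ultimately show "x \<otimes>\<^bsub>L\<^esub> y \<in> T"
      using kl xy K.m_closed[OF kl(1,2)] L.m_closed unfolding T_def by blast
  next
    fix x y assume "x \<in> carrier L" "canonical_le L x y" "y \<in> T"
    then show "x \<in> T" unfolding T_def using L.cle_trans[of x y] KL by blast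
  qed
  interpret T: convex_subsemiring L T by (rule T)
  have divide_mem: "k \<otimes>\<^bsub>K\<^esub> inv\<^bsub>K\<^esub> u \<in> T"
    if "k \<in> carrier K" "u \<in> Units K" "canonical_le E (v k) (v u)" for k u
  proof (rule T_memI)
    show "canonical_le E (v (k \<otimes>\<^bsub>K\<^esub> inv\<^bsub>K\<^esub> u)) \<one>\<^bsub>E\<^esub>"
      using E.mult_cle_right[OF that(3), of "v (inv\<^bsub>K\<^esub> u)"] that by (simp add: v v_inv)
  qed (use that in simp)
  have divide_mult: "k = (k \<otimes>\<^bsub>K\<^esub> inv\<^bsub>K\<^esub> u) \<otimes>\<^bsub>L\<^esub> u" if "k \<in> carrier K" "u \<in> Units K" for k u
    using that by (simp add: K.m_assoc flip: sub(4))

  \<comment> \<open>Since \<open>j\<close> is to be injective, a solution has to keep these elements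
    out of the region where \<open>w\<close> is at most 1. For two units the quotient can be formed
    in \<open>K\<close>; by totality of \<open>E\<close> it or its inverse has value at most 1 and
    hence lies in \<open>T\<close>.\<close>
  define S where "S = {u \<in> Units K. \<not> canonical_le E (v u) \<one>\<^bsub>E\<^esub>}"
  have "T \<inter> S = {}"
  proof (safe, simp)
    fix u assume "u \<in> T" "u \<in> S"
    then obtain k where u: "u \<in> carrier K" "\<not> canonical_le E (v u) \<one>\<^bsub>E\<^esub>" and k: "k \<in> carrier K"
      "canonical_le E (v k) \<one>\<^bsub>E\<^esub>" "canonical_le L u k"
      by (auto simp: T_def S_def)
    then have "canonical_le E (v u) (v k)" by (intro v_mono) (auto simp: le_KL)
    with k u show False using E.cle_trans[of "v u" "v k" "\<one>\<^bsub>E\<^esub>"] by (simp add: v)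
  qed
  moreover have "S \<subseteq> carrier L" by (auto simp: S_def KL)
  moreover have "(\<exists>t\<in>T. x = t \<otimes>\<^bsub>L\<^esub> y) \<or> (\<exists>t\<in>T. y = t \<otimes>\<^bsub>L\<^esub> x)" if "x \<in> S" "y \<in> S" for x y
    using that E.canonical_le_total[of "v x" "v y"] divide_mem divide_mult
    unfolding S_def by (smt (verit) K.Units_closed mem_Collect_eq v(1))
  ultimately obtain M where "convex_subsemiring L M" and TM: "T \<subseteq> M" and MS: "M \<inter> S = {}"
    and total: "\<And>g. g \<in> Units L \<Longrightarrow> g \<in> M \<or> inv\<^bsub>L\<^esub> g \<in> M"
    using T.exists_total_extension[OF assms(6)] by metis
  interpret M: convex_subsemiring L M by fact

  \<comment> \<open>The source of \<open>j\<close>: the passage from values to the preorder makes it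
    well defined, the converse makes it injective.\<close>
  have pre_iff: "M.preorder_of k l \<longleftrightarrow> canonical_le E (v k) (v l)"
    if k: "k \<in> carrier K" and l: "l \<in> carrier K" for k l
  proof
    assume le: "canonical_le E (v k) (v l)"
    \<comment> \<open>For nonzero \<open>l\<close> there is a unit \<open>u\<close> below
      \<open>l\<close> of the same value, and \<open>k = (k/u) u <= (k/u) l\<close> with
      \<open>k/u\<close> in \<open>T\<close>. For \<open>l = 0\<close> triviality of the kernel of
      \<open>v\<close> gives \<open>k = 0\<close>.\<close>
    show "M.preorder_of k l"
    proof (cases "l = \<zero>\<^bsub>K\<^esub>")
      case True
      with le have "v k = \<zero>\<^bsub>E\<^esub>" using k by (simp add: canonical_le_def v)
      then have "k = \<zero>\<^bsub>L\<^esub>" using v_zero k sub by simp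
      then show ?thesis using l by (auto intro: M.preorder_ofI L.zero_cle KL)
    next
      case False
      then obtain u where u: "u \<in> Units K" "canonical_le K u l" "v u = v l"
        using unit_below l by metis
      let ?t = "k \<otimes>\<^bsub>K\<^esub> inv\<^bsub>K\<^esub> u"
      have "?t \<in> M" using divide_mem[OF k u(1)] le u TM by auto
      moreover have "canonical_le L k (?t \<otimes>\<^bsub>L\<^esub> l)"
        using L.mult_cle_left[of u l ?t] u k l KL divide_mult[OF k u(1)]
        by (simp add: le_KL)
      ultimately show ?thesis by (auto simp: M.preorder_of_def)
    qed
  next
    assume "M.preorder_of k l"
    then obtain t where t: "t \<in> M" and le: "canonical_le L k (t \<otimes>\<^bsub>L\<^esub> l)"
      by (auto simp: M.preorder_of_def)
    have tc: "t \<in> carrier L" using t by (rule M.mem_carrier)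
    show "canonical_le E (v k) (v l)"
    proof (rule ccontr)
      assume n: "\<not> ?thesis"
      have kn: "k \<noteq> \<zero>\<^bsub>K\<^esub>" using n l by (auto simp: v E.zero_cle)
      have ln: "l \<noteq> \<zero>\<^bsub>K\<^esub>"
      proof
        assume "l = \<zero>\<^bsub>K\<^esub>"
        with le tc k have "k = \<zero>\<^bsub>K\<^esub>" by (simp add: sub canonical_le_def KL)
        with kn show False ..
      qed
      \<comment> \<open>The units \<open>a\<close> and \<open>b\<close> stand in for
        \<open>k\<close> and \<open>l\<close>. From \<open>a <= k <= t l\<close> follows
        \<open>a/b <= t (l/b)\<close>, where \<open>l/b\<close> has value 1 and so is in
        \<open>M\<close>. Thus the unit \<open>a/b\<close> lies in \<open>M\<close>, hence outside
        \<open>S\<close>, which forces its value to be at most 1.\<close>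
      obtain a where a: "a \<in> Units K" "canonical_le K a k" "v a = v k"
        using unit_below[OF k kn] .
      obtain b where b: "b \<in> Units K" "canonical_le K b l" "v b = v l"
        using unit_below[OF l ln] .
      let ?b' = "inv\<^bsub>K\<^esub> b"
      have car: "a \<in> carrier K" "b \<in> carrier K" "?b' \<in> carrier K" using a b by auto
      have "canonical_le L a (t \<otimes>\<^bsub>L\<^esub> l)"
        using L.cle_trans[OF _ le, of a] a k l tc car by (simp add: le_KL KL)
      then have "canonical_le L (a \<otimes>\<^bsub>L\<^esub> ?b') (t \<otimes>\<^bsub>L\<^esub> l \<otimes>\<^bsub>L\<^esub> ?b')"
        using car l tc by (intro L.mult_cle_right) (auto simp: KL)
      moreover have "t \<otimes>\<^bsub>L\<^esub> l \<otimes>\<^bsub>L\<^esub> ?b' = t \<otimes>\<^bsub>L\<^esub> (l \<otimes>\<^bsub>K\<^esub> ?b')"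
        using car l tc by (simp add: L.m_assoc KL sub)
      moreover have "l \<otimes>\<^bsub>K\<^esub> ?b' \<in> M"
        using divide_mem[OF l b(1)] b(3) TM l by (auto simp: E.cle_refl v)
      ultimately have "a \<otimes>\<^bsub>L\<^esub> ?b' \<in> M"
        using M.down_mem M.mult_mem[OF t] car by (metis L.m_closed KL)
      then have "a \<otimes>\<^bsub>K\<^esub> ?b' \<in> M" using car by (simp add: sub)
      moreover have "a \<otimes>\<^bsub>K\<^esub> ?b' \<in> Units K" using a b by simp
      ultimately have "canonical_le E (v (a \<otimes>\<^bsub>K\<^esub> ?b')) \<one>\<^bsub>E\<^esub>"
        using MS by (auto simp: S_def)
      then have "canonical_le E (v (a \<otimes>\<^bsub>K\<^esub> ?b') \<otimes>\<^bsub>E\<^esub> v b) (\<one>\<^bsub>E\<^esub> \<otimes>\<^bsub>E\<^esub> v b)"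
        using car by (intro E.mult_cle_right) (auto simp: v)
      moreover have "v (a \<otimes>\<^bsub>K\<^esub> ?b') \<otimes>\<^bsub>E\<^esub> v b = v a"
        using v(3)[of "a \<otimes>\<^bsub>K\<^esub> ?b'" b] car b(1) by (simp add: K.m_assoc)
      ultimately have "canonical_le E (v a) (v b)"
        using car by (simp add: v(1))
      with a b n show False by simp
    qed
  qed

  let ?F = "image_structure L M.residue_class"
  have F: "totally_ordered_idempotent_semifield ?F" and w: "M.residue_class \<in> semiring_hom L ?F"
    using M.total_quotient[OF assms(6) total] by auto
  note w' = semiring_homD[OF w]
  have class_iff: "M.residue_class k = M.residue_class l \<longleftrightarrow> v k = v l"
    if "k \<in> carrier K" "l \<in> carrier K" for k l
    using that E.cle_antisym[of "v k" "v l"]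
    by (auto simp: M.residue_class_eq_iff KL pre_iff v E.cle_refl)
  \<comment> \<open>A preimage under \<open>v\<close> is chosen; by \<open>class_iff\<close> its
    class does not depend on the choice.\<close>
  define j where "j e = M.residue_class (inv_into (carrier K) v e)" for e
  have j: "j (v k) = M.residue_class k" if "k \<in> carrier K" for k
    using that by (simp add: j_def class_iff inv_into_into f_inv_into_f)
  have "j \<in> semiring_hom E ?F"
  proof -
    have "j (v k) \<in> carrier ?F" if "k \<in> carrier K" for k
      using that by (simp add: j w' KL)
    moreover have "j (v k \<otimes>\<^bsub>E\<^esub> v l) = j (v k) \<otimes>\<^bsub>?F\<^esub> j (v l)"
      "j (v k \<oplus>\<^bsub>E\<^esub> v l) = j (v k) \<oplus>\<^bsub>?F\<^esub> j (v l)"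
      if "k \<in> carrier K" "l \<in> carrier K" for k l
    proof -
      have "j (v k \<otimes>\<^bsub>E\<^esub> v l) = M.residue_class (k \<otimes>\<^bsub>K\<^esub> l)"
        "j (v k \<oplus>\<^bsub>E\<^esub> v l) = M.residue_class (k \<oplus>\<^bsub>K\<^esub> l)"
        using that by (simp_all add: j flip: v(2,3))
      then show "j (v k \<otimes>\<^bsub>E\<^esub> v l) = j (v k) \<otimes>\<^bsub>?F\<^esub> j (v l)"
        "j (v k \<oplus>\<^bsub>E\<^esub> v l) = j (v k) \<oplus>\<^bsub>?F\<^esub> j (v l)"
        using that by (simp_all add: j w' KL sub)
    qed
    moreover have "j \<one>\<^bsub>E\<^esub> = \<one>\<^bsub>?F\<^esub>" "j \<zero>\<^bsub>E\<^esub> = \<zero>\<^bsub>?F\<^esub>"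
    proof -
      have "j \<one>\<^bsub>E\<^esub> = M.residue_class \<one>\<^bsub>K\<^esub>" "j \<zero>\<^bsub>E\<^esub> = M.residue_class \<zero>\<^bsub>K\<^esub>"
        by (simp_all add: j flip: v(4,5))
      then show "j \<one>\<^bsub>E\<^esub> = \<one>\<^bsub>?F\<^esub>" "j \<zero>\<^bsub>E\<^esub> = \<zero>\<^bsub>?F\<^esub>"
        by (simp_all add: sub w')
    qed
    ultimately show ?thesis
      \<comment> \<open>Surjectivity of \<open>v\<close> replaces the carrier of \<open>E\<close> by
        the image of \<open>K\<close>, so laws checked on values \<open>v k\<close> suffice.\<close>
      unfolding semiring_hom_def ring_hom_def assms(5)[symmetric] by auto
  qed
  moreover have "inj_on j (carrier E)"
    unfolding assms(5)[symmetric] by (auto simp: inj_on_def j class_iff)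
  moreover have "\<forall>x\<in>carrier K. (M.residue_class \<circ> i) x = (j \<circ> v) x"
    using assms(8) by (simp add: j)
  ultimately show ?thesis using F w by blast
qed

end
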